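(* Let $$Q(\nu)=a_1\nu^2-2b_1\nu+2c_1,\qquad P(\nu)=a_2\nu^2-2b_2\nu+2c_2$$ be real quadratic expressions in $\nu$ such that $Q(\nu)>0$ for every $\nu\in\mathbb R$, and set $$A=\begin{pmatrix}a_2&-b_2\\-b_2&2c_2\end{pmatrix},\qquad B=\begin{pmatrix}a_1&-b_1\\-b_1&2c_1\end{pmatrix}.$$ Then $$\min_{\nu\in\mathbb R}\frac{Q(\nu)}{|P(\nu)|}=\Big(\max_{\lambda\ \text{eigenvalue of}\ B^{-1/2}AB^{-1/2}}|\lambda|\Big)^{-1}.$$
   Context: Here $a_1,b_1,c_1,a_2,b_2,c_2$ are real numbers, and $B^{-1/2}$ is the inverse of the symmetric square root of $B$. In the derivation, $B$ is asserted to be positive definite (with positive eigenvalues) in the setting $Q>0$, so that $B^{-1/2}$ makes sense and $B^{-1/2}AB^{-1/2}$ is a symmetric matrix.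
   Formalization: The minimum may not exist (Q=ν²+1, P=ν²), so it is proved as an infimum that is attained or is the limit as |ν|→∞; a₁≠0 is assumed, since for constant Q the matrix B is singular and B^{-1/2} undefined; Q/|P| is read as ∞ where P=0, and 0^{-1}=∞. *)

theory Defs
  imports "HOL-Analysis.Analysis"
begin

definition pos_semidef :: "real^'n^'n \<Rightarrow> bool" where
  "pos_semidef M \<longleftrightarrow> transpose M = M \<and> (\<forall>x. 0 \<le> x \<bullet> (M *v x))"

text \<open>
  The symmetric square root is the unique symmetric positive semidefinite square root;
  it is meaningful only for symmetric positive semidefinite arguments.
\<close>
definition matrix_sqrt :: "real^'n^'n \<Rightarrow> real^'n^'n" where
  "matrix_sqrt M = (THE S. pos_semidef S \<and> S ** S = M)"

definition eigenvalue :: "real^'n^'n \<Rightarrow> real \<Rightarrow> bool" where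
  "eigenvalue M l \<longleftrightarrow> (\<exists>v. v \<noteq> 0 \<and> M *v v = l *\<^sub>R v)"

end

theory Submission
  imports Defs
begin

text \<open>
  Put \<open>w = (\<nu>, 1)\<close>, so that \<open>P \<nu> = w \<bullet> A w\<close> and \<open>Q \<nu> = w \<bullet> B w\<close>. If \<open>S\<close> is the square root
  of \<open>B\<close> and \<open>R\<close> its inverse, the substitution \<open>u = S w\<close> turns \<open>Q\<close> into \<open>u \<bullet> u\<close> and \<open>P\<close> into
  \<open>u \<bullet> R A R u\<close>. Hence \<open>\<bar>P\<bar> / Q\<close> is the absolute Rayleigh quotient of the symmetric matrix \<open>R A R\<close>,
  whose supremum over all directions is the largest absolute value \<open>L\<close> of an eigenvalue and is
  reached at an eigenvector (\<open>Max_abs_eigenvalue_symmetric\<close>, transported to the pair of forms in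
  \<open>pencil_numerical_radius\<close>). The ratio is homogeneous of degree 0 in \<open>w\<close>, and every direction of
  the plane except that of \<open>(1, 0)\<close> contains some \<open>(\<nu>, 1)\<close>; the exceptional direction is the limit
  \<open>\<bar>\<nu>\<bar> \<rightarrow> \<infinity>\<close> (\<open>quadratic_ratio_tendsto\<close>). So \<open>inverse L\<close> bounds \<open>Q / \<bar>P\<bar>\<close> from below, and it is a
  value or the limit at infinity, according to the direction of the extremal vector.

  Both the Rayleigh bound and the uniqueness of the square root rest on one fact,
  \<open>psd_isotropic_in_kernel\<close>: a positive semidefinite form vanishes at a vector only if the matrix
  annihilates it. Uniqueness is proved in every dimension; existence of the square root is
  an explicit formula for \<open>2 \<times> 2\<close> matrices.
\<close>

section \<open>Extremal eigenvalues of symmetric matrices\<close>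

lemma symmetric_dot:
  fixes C :: "real^'n^'n"
  assumes "transpose C = C"
  shows "(C *v x) \<bullet> y = x \<bullet> (C *v y)"
  by (metis assms dot_lmul_matrix transpose_matrix_vector)

text \<open>
  With \<open>y = N x\<close>, the form at \<open>x - t y\<close> is \<open>- 2 t (y \<bullet> y) + t\<^sup>2 (y \<bullet> N y)\<close>, which would be negative for
  small positive \<open>t\<close> if \<open>y\<close> were nonzero.
\<close>
lemma psd_isotropic_in_kernel:
  assumes N: "pos_semidef N" and x: "x \<bullet> (N *v x) = 0"
  shows "N *v x = 0"
proof (rule ccontr)
  assume "N *v x \<noteq> 0"
  define y where "y = N *v x"
  define k where "k = y \<bullet> (N *v y)"
  define t where "t = (y \<bullet> y) / (k + 1)"
  have yy: "y \<bullet> y > 0" using \<open>N *v x \<noteq> 0\<close> by (simp add: y_def)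
  have k: "k \<ge> 0" using N by (simp add: k_def pos_semidef_def)
  have "t > 0" using yy k by (simp add: t_def)
  have xNy: "x \<bullet> (N *v y) = y \<bullet> y"
    using N symmetric_dot[of N x y] by (simp add: pos_semidef_def y_def)
  have "(x - t *\<^sub>R y) \<bullet> (N *v (x - t *\<^sub>R y)) = - (2 * t * (y \<bullet> y)) + t * (t * k)"
    using x xNy by (simp add: matrix_vector_mult_diff_distrib matrix_vector_mult_scaleR
        inner_diff_left inner_diff_right y_def[symmetric] k_def algebra_simps inner_commute)
  also have "t * k \<le> y \<bullet> y"
    using yy k by (simp add: t_def field_simps)
  hence "- (2 * t * (y \<bullet> y)) + t * (t * k) \<le> - (t * (y \<bullet> y))"
    using mult_left_mono[of "t * k" "y \<bullet> y" t] \<open>t > 0\<close> by linarith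
  also have "\<dots> < 0" using \<open>t > 0\<close> yy by simp
  finally have "(x - t *\<^sub>R y) \<bullet> (N *v (x - t *\<^sub>R y)) < 0" .
  moreover have "0 \<le> (x - t *\<^sub>R y) \<bullet> (N *v (x - t *\<^sub>R y))"
    using N unfolding pos_semidef_def by blast
  ultimately show False by linarith
qed

text \<open>
  By compactness \<open>\<bar>x \<bullet> C x\<bar>\<close> has a maximum on the unit sphere, at some \<open>u\<close> with \<open>u \<bullet> C u = l\<close>. If \<open>s\<close> is
  the sign of \<open>l\<close>, the matrix \<open>\<bar>l\<bar> I - s C\<close> is positive semidefinite and its form vanishes at \<open>u\<close>.
  Therefore it annihilates \<open>u\<close>, which makes \<open>u\<close> an eigenvector.
\<close>
lemma symmetric_extremal_eigenvalue:
  fixes C :: "real^'n^'n"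
  assumes sym: "transpose C = C"
  obtains l where "eigenvalue C l" "\<And>x. \<bar>x \<bullet> (C *v x)\<bar> \<le> \<bar>l\<bar> * (x \<bullet> x)"
proof -
  have cont: "continuous_on (sphere 0 1) (\<lambda>x. \<bar>x \<bullet> (C *v x)\<bar>)"
    by (intro continuous_intros linear_continuous_on matrix_vector_mul_bounded_linear)
  have "sphere (0::real^'n) 1 \<noteq> {}"
    using vector_choose_size[of 1] by (auto simp: dist_norm)
  then obtain u where u: "u \<in> sphere (0::real^'n) 1"
    and umax: "\<And>x. x \<in> sphere 0 1 \<Longrightarrow> \<bar>x \<bullet> (C *v x)\<bar> \<le> \<bar>u \<bullet> (C *v u)\<bar>"
    using continuous_attains_sup[OF compact_sphere _ cont] by blast
  define l where "l = u \<bullet> (C *v u)"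
  have uu: "u \<bullet> u = 1" using u by (simp add: dot_square_norm)
  have bound: "\<bar>x \<bullet> (C *v x)\<bar> \<le> \<bar>l\<bar> * (x \<bullet> x)" for x
  proof (cases "x = 0")
    case False
    define e where "e = x /\<^sub>R norm x"
    have "e \<in> sphere 0 1" using False by (simp add: e_def)
    hence "\<bar>e \<bullet> (C *v e)\<bar> \<le> \<bar>l\<bar>" using umax by (simp add: l_def)
    moreover have x: "x = norm x *\<^sub>R e" using False by (simp add: e_def)
    have "x \<bullet> (C *v x) = (norm x)\<^sup>2 * (e \<bullet> (C *v e))"
      by (subst (1 2) x) (simp add: matrix_vector_mult_scaleR power2_eq_square)
    ultimately show ?thesis
      by (simp add: abs_mult dot_square_norm mult.commute[of _ "(norm x)\<^sup>2"] mult_left_mono)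
  qed simp
  define s :: real where "s = (if l \<ge> 0 then 1 else -1)"
  define N where "N = \<bar>l\<bar> *\<^sub>R mat 1 - s *\<^sub>R C"
  have s: "s * l = \<bar>l\<bar>" "s * s = 1" "\<bar>s\<bar> = 1" by (auto simp: s_def)
  have Nx: "N *v x = \<bar>l\<bar> *\<^sub>R x - s *\<^sub>R (C *v x)" for x
    by (simp add: N_def matrix_vector_mult_diff_rdistrib scaleR_matrix_vector_assoc[symmetric])
  have "transpose N = N"
    using sym by (simp add: N_def transpose_def mat_def vec_eq_iff)
  moreover have "0 \<le> x \<bullet> (N *v x)" for x
  proof -
    have "s * (x \<bullet> (C *v x)) \<le> \<bar>x \<bullet> (C *v x)\<bar>"
      using s(3) abs_ge_self[of "s * (x \<bullet> (C *v x))"] by (simp add: abs_mult)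
    thus ?thesis using bound[of x] by (simp add: Nx inner_diff_right)
  qed
  ultimately have "pos_semidef N" by (simp add: pos_semidef_def)
  moreover have "u \<bullet> (N *v u) = 0"
    using s(1) uu by (simp add: Nx inner_diff_right l_def[symmetric])
  ultimately have "N *v u = 0" by (rule psd_isotropic_in_kernel)
  hence "s *\<^sub>R s *\<^sub>R (C *v u) = s *\<^sub>R \<bar>l\<bar> *\<^sub>R u" by (simp add: Nx)
  hence "C *v u = l *\<^sub>R u"
    using s by (metis scaleR_scaleR scaleR_one mult.assoc mult_1)
  moreover have "u \<noteq> 0" using uu by auto
  ultimately have "eigenvalue C l" unfolding eigenvalue_def by blast
  thus thesis using bound that by blast
qed

text \<open>
  Eigenvectors of different eigenvalues are orthogonal, and an orthogonal family in a
  finite-dimensional space is finite. Without finiteness the maximum of the spectrum would be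
  unspecified.
\<close>
lemma finite_eigenvalues_symmetric:
  fixes C :: "real^'n^'n"
  assumes sym: "transpose C = C"
  shows "finite {l. eigenvalue C l}"
proof -
  have "\<forall>l. \<exists>v. eigenvalue C l \<longrightarrow> v \<noteq> 0 \<and> C *v v = l *\<^sub>R v"
    unfolding eigenvalue_def by blast
  then obtain f where f: "\<And>l. eigenvalue C l \<Longrightarrow> f l \<noteq> 0 \<and> C *v f l = l *\<^sub>R f l"
    by metis
  have orth: "f l \<bullet> f k = 0" if "eigenvalue C l" "eigenvalue C k" "l \<noteq> k" for l k
  proof -
    have "l * (f l \<bullet> f k) = k * (f l \<bullet> f k)"
      using symmetric_dot[OF sym, of "f l" "f k"] f that by simp
    thus ?thesis using that by simp
  qed
  have "pairwise orthogonal (f ` {l. eigenvalue C l})"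
    using orth unfolding pairwise_def orthogonal_def by blast
  hence "finite (f ` {l. eigenvalue C l})" by (rule pairwise_orthogonal_imp_finite)
  moreover have "inj_on f {l. eigenvalue C l}"
    using orth f by (intro inj_onI) (metis inner_eq_zero_iff mem_Collect_eq)
  ultimately show ?thesis by (rule finite_imageD)
qed

lemma Max_abs_eigenvalue_symmetric:
  fixes C :: "real^'n^'n"
  assumes sym: "transpose C = C"
  defines "L \<equiv> Max {\<bar>l\<bar> |l. eigenvalue C l}"
  shows "\<bar>x \<bullet> (C *v x)\<bar> \<le> L * (x \<bullet> x)"
    and "\<exists>u. u \<noteq> 0 \<and> \<bar>u \<bullet> (C *v u)\<bar> = L * (u \<bullet> u)"
proof -
  obtain l where l: "eigenvalue C l" and bound: "\<And>x. \<bar>x \<bullet> (C *v x)\<bar> \<le> \<bar>l\<bar> * (x \<bullet> x)"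
    using symmetric_extremal_eigenvalue[OF sym] by blast
  have le: "\<bar>k\<bar> \<le> \<bar>l\<bar>" if k: "eigenvalue C k" for k
  proof -
    obtain v where "v \<noteq> 0" "C *v v = k *\<^sub>R v" using k unfolding eigenvalue_def by blast
    thus ?thesis using bound[of v] by (simp add: abs_mult)
  qed
  have "finite {\<bar>l\<bar> |l. eigenvalue C l}"
    using finite_eigenvalues_symmetric[OF sym] by (simp add: setcompr_eq_image)
  hence L: "L = \<bar>l\<bar>"
    unfolding L_def using l le by (intro Max_eqI) auto
  show "\<bar>x \<bullet> (C *v x)\<bar> \<le> L * (x \<bullet> x)" using bound L by simp
  obtain v where "v \<noteq> 0" "C *v v = l *\<^sub>R v" using l unfolding eigenvalue_def by blast
  thus "\<exists>u. u \<noteq> 0 \<and> \<bar>u \<bullet> (C *v u)\<bar> = L * (u \<bullet> u)"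
    by (intro exI[of _ v]) (simp add: L abs_mult)
qed

section \<open>The square root of a positive semidefinite matrix\<close>

text \<open>
  Let \<open>v\<close> be an extremal eigenvector of \<open>D = S - T\<close>, with eigenvalue \<open>l\<close>. From \<open>\<parallel>S v\<parallel> = \<parallel>T v\<parallel>\<close> and
  \<open>S v = T v + l v\<close> follows \<open>l (v \<bullet> S v + v \<bullet> T v) = 0\<close>. If the second factor vanishes, both \<open>S\<close> and \<open>T\<close>
  annihilate \<open>v\<close>, so \<open>l = 0\<close> in every case. As \<open>l\<close> is extremal, the form of \<open>D\<close> vanishes
  identically, and \<open>D = 0\<close>.
\<close>
lemma pos_semidef_sqrt_unique:
  assumes S: "pos_semidef S" and T: "pos_semidef T" and eq: "S ** S = T ** T"
  shows "S = T"
proof -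
  define D where "D = S - T"
  have Dx: "D *v x = S *v x - T *v x" for x
    by (simp add: D_def matrix_vector_mult_diff_rdistrib)
  have SS: "S *v (S *v x) = T *v (T *v x)" for x
    using eq by (simp add: matrix_vector_mul_assoc)
  have symS: "transpose S = S" and symT: "transpose T = T"
    using S T by (auto simp: pos_semidef_def)
  hence sym: "transpose D = D"
    by (simp add: D_def transpose_def vec_eq_iff)
  obtain l where l: "eigenvalue D l" and bound: "\<And>x. \<bar>x \<bullet> (D *v x)\<bar> \<le> \<bar>l\<bar> * (x \<bullet> x)"
    using symmetric_extremal_eigenvalue[OF sym] by blast
  obtain v where v: "v \<noteq> 0" and Dv: "D *v v = l *\<^sub>R v"
    using l unfolding eigenvalue_def by blast
  have Sv: "S *v v = T *v v + l *\<^sub>R v" using Dv Dx[of v] by (simp add: algebra_simps)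
  have "l * (v \<bullet> (S *v v) + v \<bullet> (T *v v)) = 0"
  proof -
    have "v \<bullet> (S *v (S *v v)) = (S *v v) \<bullet> (S *v v)"
      "v \<bullet> (T *v (T *v v)) = (T *v v) \<bullet> (T *v v)"
      by (simp_all add: symmetric_dot symS symT)
    hence "(S *v v) \<bullet> (S *v v) = (T *v v) \<bullet> (T *v v)" by (simp add: SS)
    thus ?thesis
      unfolding Sv by (simp add: inner_add_left inner_add_right inner_commute algebra_simps)
  qed
  moreover have "0 \<le> v \<bullet> (S *v v)" "0 \<le> v \<bullet> (T *v v)"
    using S T by (auto simp: pos_semidef_def)
  ultimately have "l = 0 \<or> (v \<bullet> (S *v v) = 0 \<and> v \<bullet> (T *v v) = 0)" by auto
  hence "l = 0"
    using psd_isotropic_in_kernel[OF S, of v] psd_isotropic_in_kernel[OF T, of v] Sv v by auto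
  hence "x \<bullet> (D *v x) = 0" for x using bound[of x] by simp
  moreover from this have "pos_semidef D" using sym by (simp add: pos_semidef_def)
  ultimately have "D *v x = 0" for x using psd_isotropic_in_kernel by blast
  hence "D = 0" by (simp add: matrix_eq)
  thus ?thesis by (simp add: D_def)
qed

lemma matrix_sqrt_eqI:
  assumes "pos_semidef S" "S ** S = M"
  shows "matrix_sqrt M = S"
  unfolding matrix_sqrt_def
proof (rule the_equality)
  show "pos_semidef S \<and> S ** S = M" using assms ..
  fix T
  assume T: "pos_semidef T \<and> T ** T = M"
  hence "T ** T = S ** S" unfolding assms(2) ..
  with T assms(1) show "T = S" by (blast intro: pos_semidef_sqrt_unique)
qed

text \<open>
  By Cayley--Hamilton \<open>B\<^sup>2 + d\<^sup>2 I = (trace B) B\<close> where \<open>d = sqrt (det B)\<close>, and therefore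
  \<open>(B + d I)\<^sup>2 = (trace B + 2 d) B\<close>. Dividing \<open>B + d I\<close> by the root of the scalar gives the square root.
\<close>
lemma pos_semidef_sqrt_exists_2:
  fixes B :: "real^2^2"
  assumes B: "pos_semidef B" and det: "det B > 0"
  obtains S where "pos_semidef S" "S ** S = B"
proof -
  define d where "d = sqrt (det B)"
  define t where "t = sqrt (B$1$1 + B$2$2 + 2 * d)"
  define S where "S = (1 / t) *\<^sub>R (B + d *\<^sub>R mat 1)"
  have sym: "B$2$1 = B$1$2"
  proof -
    have "transpose B $ 1 $ 2 = B$1$2" using B by (simp only: pos_semidef_def)
    thus ?thesis by (simp add: transpose_def)
  qed
  have form: "0 \<le> x \<bullet> (B *v x)" for x using B by (simp add: pos_semidef_def)
  have diag: "0 \<le> B$1$1" "0 \<le> B$2$2"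
    using form[of "axis 1 1"] form[of "axis 2 1"]
    by (simp_all add: matrix_vector_mult_basis inner_axis' column_def)
  have d: "d > 0" "d\<^sup>2 = B$1$1 * B$2$2 - B$1$2 * B$1$2"
    using det by (simp_all add: d_def det_2 sym)
  have t: "t > 0" "t\<^sup>2 = B$1$1 + B$2$2 + 2 * d"
    using diag d(1) by (simp_all add: t_def)
  have "pos_semidef S"
  proof -
    have "transpose S = S"
      using B by (simp add: pos_semidef_def S_def transpose_def mat_def vec_eq_iff)
    moreover have "x \<bullet> (S *v x) = (x \<bullet> (B *v x) + d * (x \<bullet> x)) / t" for x
      by (simp add: S_def matrix_vector_mult_add_rdistrib scaleR_matrix_vector_assoc[symmetric]
          inner_add_right)
    ultimately show ?thesis using form d(1) t(1) by (simp add: pos_semidef_def)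
  qed
  moreover have "S ** S = B"
  proof -
    have "(B + d *\<^sub>R mat 1) ** (B + d *\<^sub>R mat 1) = (B$1$1 + B$2$2 + 2 * d) *\<^sub>R B"
    proof -
      have "d * d = B$1$1 * B$2$2 - B$1$2 * B$1$2" using d(2) by (simp only: power2_eq_square)
      thus ?thesis
        by (simp add: vec_eq_iff forall_2 matrix_matrix_mult_def sum_2 mat_def sym
            ring_distribs mult_ac)
    qed
    hence "(B + d *\<^sub>R mat 1) ** (B + d *\<^sub>R mat 1) = t\<^sup>2 *\<^sub>R B" by (simp only: t(2))
    hence "S ** S = (1 / t) *\<^sub>R (1 / t) *\<^sub>R t\<^sup>2 *\<^sub>R B"
      unfolding S_def by (simp only: matrix_scalar_ac scalar_matrix_assoc[symmetric])
    thus ?thesis using t(1) by (simp add: power2_eq_square)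
  qed
  ultimately show thesis by (rule that)
qed

lemma invertible_matrix_inv:
  fixes S :: "real^'n^'n"
  assumes "invertible S"
  shows "S ** matrix_inv S = mat 1" "matrix_inv S ** S = mat 1"
proof -
  have "S ** matrix_inv S = mat 1 \<and> matrix_inv S ** S = mat 1"
    using assms unfolding invertible_def matrix_inv_def by (rule someI_ex)
  thus "S ** matrix_inv S = mat 1" "matrix_inv S ** S = mat 1" by auto
qed

section \<open>The ratio of two quadratic forms\<close>

text \<open>
  The substitution \<open>u = S w\<close> is a bijection that takes the form of \<open>A\<close> at \<open>w\<close> to that of \<open>R A R\<close> at \<open>u\<close>,
  and the form of \<open>S\<^sup>2\<close> at \<open>w\<close> to \<open>u \<bullet> u\<close>.
\<close>
lemma pencil_numerical_radius:
  fixes A S :: "real^'n^'n"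
  assumes symA: "transpose A = A" and symS: "transpose S = S" and inv: "invertible S"
  defines "R \<equiv> matrix_inv S"
  defines "L \<equiv> Max {\<bar>l\<bar> |l. eigenvalue (R ** A ** R) l}"
  shows "\<bar>w \<bullet> (A *v w)\<bar> \<le> L * (w \<bullet> ((S ** S) *v w))"
    and "\<exists>w. w \<noteq> 0 \<and> \<bar>w \<bullet> (A *v w)\<bar> = L * (w \<bullet> ((S ** S) *v w))"
proof -
  have SR: "S ** R = mat 1" and RS: "R ** S = mat 1"
    using invertible_matrix_inv[OF inv] by (simp_all add: R_def)
  have "transpose R ** S = mat 1"
    using SR symS by (metis matrix_transpose_mul transpose_mat)
  hence symR: "transpose R = R"
    using SR by (metis matrix_mul_assoc matrix_mul_lid matrix_mul_rid)
  have symC: "transpose (R ** A ** R) = R ** A ** R"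
    using symA symR by (simp add: matrix_transpose_mul matrix_mul_assoc)
  have RSw: "R *v (S *v w) = w" and SRw: "S *v (R *v w) = w" for w
    by (simp_all add: matrix_vector_mul_assoc RS SR)
  have C: "(S *v w) \<bullet> ((R ** A ** R) *v (S *v w)) = w \<bullet> (A *v w)" for w
  proof -
    have "(R ** A ** R) *v (S *v w) = R *v (A *v w)"
      using RSw[of w] by (metis matrix_vector_mul_assoc)
    thus ?thesis using symmetric_dot[OF symR, of "S *v w" "A *v w"] RSw by simp
  qed
  have B: "(S *v w) \<bullet> (S *v w) = w \<bullet> ((S ** S) *v w)" for w
    by (simp add: symmetric_dot[OF symS] matrix_vector_mul_assoc)
  note radius = Max_abs_eigenvalue_symmetric[OF symC, folded L_def]
  show "\<bar>w \<bullet> (A *v w)\<bar> \<le> L * (w \<bullet> ((S ** S) *v w))"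
    using radius(1)[of "S *v w"] unfolding C B .
  obtain u where u: "u \<noteq> 0" "\<bar>u \<bullet> ((R ** A ** R) *v u)\<bar> = L * (u \<bullet> u)"
    using radius(2) by blast
  have "R *v u \<noteq> 0" using u(1) SRw[of u] by auto
  moreover have "\<bar>(R *v u) \<bullet> (A *v (R *v u))\<bar> = L * ((R *v u) \<bullet> ((S ** S) *v (R *v u)))"
    using u(2) unfolding C[symmetric] B[symmetric] SRw .
  ultimately show "\<exists>w. w \<noteq> 0 \<and> \<bar>w \<bullet> (A *v w)\<bar> = L * (w \<bullet> ((S ** S) *v w))" by blast
qed

lemma inner_matrix_2:
  fixes w :: "real^2"
  shows "w \<bullet> (vector [vector [a, - b], vector [- b, c]] *v w)
    = a * (w$1)\<^sup>2 - 2 * b * (w$1 * w$2) + c * (w$2)\<^sup>2"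
  by (simp add: inner_vec_def sum_2 matrix_vector_mult_def power2_eq_square algebra_simps)

lemma transpose_matrix_2:
  "transpose (vector [vector [a, - b], vector [- b, c]] :: real^2^2)
    = vector [vector [a, - b], vector [- b, c]]"
  by (simp add: transpose_def vec_eq_iff forall_2)

text \<open>
  At \<open>p = 0\<close> the right-hand side is \<open>\<infinity>\<close>, so no case is lost by passing to reciprocals. The same
  convention gives the equality for \<open>L = 0\<close> in the next lemma, both sides being \<open>\<infinity>\<close>.
\<close>
lemma inverse_le_ereal_ratio:
  fixes p q L :: real
  assumes "0 < q" "\<bar>p\<bar> \<le> L * q"
  shows "inverse (ereal L) \<le> ereal q / ereal \<bar>p\<bar>"
proof (cases "p = 0")
  case False
  hence "0 < L * q" using assms by linarith
  hence "0 < L" using assms(1) by (simp add: zero_less_mult_iff)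
  thus ?thesis using False assms by (simp add: field_simps)
qed (use assms(1) in simp)

lemma ereal_ratio_eq_inverse:
  fixes p q L :: real
  assumes "0 < q" "\<bar>p\<bar> = L * q"
  shows "ereal q / ereal \<bar>p\<bar> = inverse (ereal L)"
  using assms by (cases "L = 0") (simp_all add: field_simps)

section \<open>The minimum of the ratio\<close>

text \<open>
  Numerator and denominator are \<open>x\<^sup>2\<close> times polynomials in \<open>1 / x\<close> with limits \<open>a\<close> and \<open>a'\<close>. Since \<open>a'\<close>
  is nonzero, the denominator is eventually nonzero and the quotient is eventually real.
\<close>
lemma quadratic_ratio_tendsto:
  fixes a b c a' b' c' :: real
  assumes "a' \<noteq> 0"
  shows "((\<lambda>x. ereal (a * x\<^sup>2 - b * x + c) / ereal \<bar>a' * x\<^sup>2 - b' * x + c'\<bar>)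
    \<longlongrightarrow> ereal a / ereal \<bar>a'\<bar>) at_infinity"
proof -
  have inv0: "((\<lambda>x::real. inverse x) \<longlongrightarrow> 0) at_infinity" by (rule tendsto_inverse_0)
  have lim: "((\<lambda>x. a - b * inverse x + c * (inverse x)\<^sup>2) \<longlongrightarrow> a) at_infinity" for a b c :: real
    by (rule tendsto_eq_intros inv0 refl | simp)+
  have nz: "\<forall>\<^sub>F x::real in at_infinity. x \<noteq> 0"
    unfolding eventually_at_infinity by (intro exI[of _ 1]) auto
  have "((\<lambda>x. ereal ((a - b * inverse x + c * (inverse x)\<^sup>2) / \<bar>a' - b' * inverse x + c' * (inverse x)\<^sup>2\<bar>))
    \<longlongrightarrow> ereal (a / \<bar>a'\<bar>)) at_infinity"
    using assms by (intro tendsto_intros lim) auto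
  moreover have "\<forall>\<^sub>F x in at_infinity.
      ereal ((a - b * inverse x + c * (inverse x)\<^sup>2) / \<bar>a' - b' * inverse x + c' * (inverse x)\<^sup>2\<bar>)
      = ereal (a * x\<^sup>2 - b * x + c) / ereal \<bar>a' * x\<^sup>2 - b' * x + c'\<bar>"
    using nz tendsto_imp_eventually_ne[OF lim assms, of b' c']
  proof eventually_elim
    case (elim x)
    have scale: "r * x\<^sup>2 - s * x + t = x\<^sup>2 * (r - s * inverse x + t * (inverse x)\<^sup>2)" for r s t
      using elim(1) by (simp add: field_simps power2_eq_square)
    show ?case
      unfolding scale using elim by (simp add: abs_mult)
  qed
  ultimately have "((\<lambda>x. ereal (a * x\<^sup>2 - b * x + c) / ereal \<bar>a' * x\<^sup>2 - b' * x + c'\<bar>)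
    \<longlongrightarrow> ereal (a / \<bar>a'\<bar>)) at_infinity"
    by (rule Lim_transform_eventually)
  thus ?thesis using assms by simp
qed

(* Values are in ereal, where q / 0 = \<infinity> for q > 0 and inverse 0 = \<infinity>: this covers the zeros of P and P = 0.
   The minimum need not be attained at a real \<nu> (e.g. Q = \<nu>^2 + 1, P = \<nu>^2), so it is an infimum
   that is either attained or is the limit as |\<nu>| tends to infinity.
   a1 \<noteq> 0 excludes constant Q, for which B is singular. *)
theorem mainTheorem3:
  fixes a1 b1 c1 a2 b2 c2 :: real
    and Q P :: "real \<Rightarrow> real"
    and A B :: "real^2^2"
    and R :: "real^2^2" and m :: ereal
  assumes Q: "\<And>\<nu>. Q \<nu> = a1 * \<nu>^2 - 2 * b1 * \<nu> + 2 * c1"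
    and P: "\<And>\<nu>. P \<nu> = a2 * \<nu>^2 - 2 * b2 * \<nu> + 2 * c2"
    and quadratic: "a1 \<noteq> 0"
    and Q_pos: "\<And>\<nu>. Q \<nu> > 0"
    and A: "A = vector [vector [a2, - b2], vector [- b2, 2 * c2]]"
    and B: "B = vector [vector [a1, - b1], vector [- b1, 2 * c1]]"
    and R: "R = matrix_inv (matrix_sqrt B)"
    and m: "m = inverse (ereal (Max {\<bar>l\<bar> |l. eigenvalue (R ** A ** R) l}))"
  shows "(INF \<nu>. ereal (Q \<nu>) / ereal \<bar>P \<nu>\<bar>) = m \<and>
    ((\<exists>\<nu>. ereal (Q \<nu>) / ereal \<bar>P \<nu>\<bar> = m) \<or>
     ((\<lambda>\<nu>. ereal (Q \<nu>) / ereal \<bar>P \<nu>\<bar>) \<longlongrightarrow> m) at_infinity)"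
proof -
  have det: "2 * a1 * c1 - b1\<^sup>2 > 0"
  proof (rule ccontr)
    assume neg: "\<not> 2 * a1 * c1 - b1\<^sup>2 > 0"
    \<comment> \<open>Otherwise \<open>Q\<close> has the real root \<open>(b1 + r) / a1\<close>.\<close>
    define r where "r = sqrt (b1\<^sup>2 - 2 * a1 * c1)"
    have "r\<^sup>2 = b1\<^sup>2 - 2 * a1 * c1" using neg by (simp add: r_def)
    moreover define y where "y = (b1 + r) / a1"
    have "a1 * y = b1 + r" using quadratic by (simp add: y_def)
    moreover have "a1 * Q y = (a1 * y)\<^sup>2 - 2 * b1 * (a1 * y) + 2 * a1 * c1"
      by (simp add: Q power2_eq_square algebra_simps)
    ultimately have "a1 * Q y = 0"
      by (simp add: power2_eq_square algebra_simps)
    thus False using Q_pos quadratic by (metis less_irrefl mult_eq_0_iff)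
  qed
  moreover have "c1 > 0" using Q_pos[of 0] by (simp add: Q)
  ultimately have a1: "a1 > 0"
    using zero_le_power2[of b1] by (smt (verit) mult_nonpos_nonneg)
  define w where "w \<nu> = (vector [\<nu>, 1] :: real^2)" for \<nu>
  have Qw: "w \<nu> \<bullet> (B *v w \<nu>) = Q \<nu>" and Pw: "w \<nu> \<bullet> (A *v w \<nu>) = P \<nu>" for \<nu>
    unfolding A B inner_matrix_2 Q P by (simp_all add: w_def)
  have homog: "x \<bullet> (M *v x) = (x$2)\<^sup>2 * (w (x$1 / x$2) \<bullet> (M *v w (x$1 / x$2)))"
    if "x$2 \<noteq> 0" for x and M :: "real^2^2"
  proof -
    have "x = (x$2) *\<^sub>R w (x$1 / x$2)"
      using that by (simp add: w_def vec_eq_iff forall_2)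
    hence "x \<bullet> (M *v x) = ((x$2) *\<^sub>R w (x$1 / x$2)) \<bullet> (M *v ((x$2) *\<^sub>R w (x$1 / x$2)))" by metis
    thus ?thesis by (simp add: matrix_vector_mult_scaleR power2_eq_square)
  qed
  have "0 \<le> x \<bullet> (B *v x)" for x
  proof (cases "x$2 = 0")
    case True
    thus ?thesis unfolding B inner_matrix_2 using a1 by simp
  next
    case False
    thus ?thesis using homog[of x B] Qw Q_pos by (simp add: less_imp_le)
  qed
  hence "pos_semidef B" by (simp add: pos_semidef_def B transpose_matrix_2)
  moreover have detB: "det B > 0"
    using det by (simp add: B det_2 power2_eq_square mult_ac)
  ultimately obtain S where S: "pos_semidef S" "S ** S = B"
    by (rule pos_semidef_sqrt_exists_2)
  have "invertible S"
    using S(2) detB by (auto simp: invertible_det_nz det_mul)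
  define L where "L = Max {\<bar>l\<bar> |l. eigenvalue (R ** A ** R) l}"
  have "transpose A = A" by (simp add: A transpose_matrix_2)
  moreover have "transpose S = S" using S(1) by (simp add: pos_semidef_def)
  ultimately have radius: "\<bar>x \<bullet> (A *v x)\<bar> \<le> L * (x \<bullet> (B *v x))"
    and attained: "\<exists>x. x \<noteq> 0 \<and> \<bar>x \<bullet> (A *v x)\<bar> = L * (x \<bullet> (B *v x))" for x
    using pencil_numerical_radius[of A S] \<open>invertible S\<close>
    unfolding S(2) L_def R matrix_sqrt_eqI[OF S] by blast+
  have m: "m = inverse (ereal L)" by (simp add: m L_def)
  have lower: "m \<le> ereal (Q \<nu>) / ereal \<bar>P \<nu>\<bar>" for \<nu>
    unfolding m using Q_pos radius[of "w \<nu>"] by (intro inverse_le_ereal_ratio) (simp_all add: Qw Pw)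
  obtain x where x: "x \<noteq> 0" "\<bar>x \<bullet> (A *v x)\<bar> = L * (x \<bullet> (B *v x))" using attained by blast
  have alt: "(\<exists>\<nu>. ereal (Q \<nu>) / ereal \<bar>P \<nu>\<bar> = m) \<or>
     ((\<lambda>\<nu>. ereal (Q \<nu>) / ereal \<bar>P \<nu>\<bar>) \<longlongrightarrow> m) at_infinity"
  proof (cases "x$2 = 0")
    case False
    have "\<bar>P (x$1 / x$2)\<bar> = L * Q (x$1 / x$2)"
      using x(2) False unfolding homog[OF False] Pw Qw by (simp add: abs_mult)
    thus ?thesis using ereal_ratio_eq_inverse[OF Q_pos] m by blast
  next
    case True
    \<comment> \<open>The extremal direction is \<open>(1, 0)\<close>, where the two forms are the leading coefficients.\<close>
    hence "x$1 \<noteq> 0" using x(1) by (simp add: vec_eq_iff forall_2)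
    hence lead: "\<bar>a2\<bar> = L * a1"
      using x(2) True unfolding A B inner_matrix_2 by (simp add: abs_mult)
    show ?thesis
    proof (cases "a2 = 0")
      case True
      \<comment> \<open>Then \<open>L = 0\<close>, so \<open>P\<close> vanishes and the ratio is \<open>\<infinity>\<close> everywhere.\<close>
      hence "L = 0" using lead a1 by simp
      hence "\<bar>P 0\<bar> = L * Q 0" using radius[of "w 0"] by (simp add: Pw Qw)
      thus ?thesis using ereal_ratio_eq_inverse[OF Q_pos] m by blast
    next
      case False
      hence "((\<lambda>\<nu>. ereal (Q \<nu>) / ereal \<bar>P \<nu>\<bar>) \<longlongrightarrow> ereal a1 / ereal \<bar>a2\<bar>) at_infinity"
        unfolding Q P by (rule quadratic_ratio_tendsto)
      thus ?thesis unfolding m ereal_ratio_eq_inverse[OF a1 lead] by blast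
    qed
  qed
  have INF_le: "(INF \<nu>. ereal (Q \<nu>) / ereal \<bar>P \<nu>\<bar>) \<le> ereal (Q \<nu>) / ereal \<bar>P \<nu>\<bar>" for \<nu>
    by (rule INF_lower) (rule UNIV_I)
  have "(INF \<nu>. ereal (Q \<nu>) / ereal \<bar>P \<nu>\<bar>) \<le> m"
    using alt
  proof (elim disjE exE)
    fix \<nu>
    assume "ereal (Q \<nu>) / ereal \<bar>P \<nu>\<bar> = m"
    thus ?thesis using INF_le[of \<nu>] by (rule subst)
  next
    assume "((\<lambda>\<nu>. ereal (Q \<nu>) / ereal \<bar>P \<nu>\<bar>) \<longlongrightarrow> m) at_infinity"
    thus ?thesis
      by (rule tendsto_lowerbound[OF _ always_eventually])
        (rule allI INF_le trivial_limit_at_infinity)+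
  qed
  moreover have "m \<le> (INF \<nu>. ereal (Q \<nu>) / ereal \<bar>P \<nu>\<bar>)"
    by (rule INF_greatest) (rule lower)
  ultimately have "(INF \<nu>. ereal (Q \<nu>) / ereal \<bar>P \<nu>\<bar>) = m" by (rule order.antisym)
  thus ?thesis using alt ..
qed

end
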